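(* Let $d\ge 2$ and let $K$ be a centrally symmetric convex body in $\mathbb{R}^d$. A maximum cardinality set consisting of translates of $K$ in pairwise intersecting Minkowski arrangement has at least $2d+3$ elements.
   Context: A convex body is a compact convex set with non-empty interior. A family of positive homothetic copies (in particular, translates) of a centrally symmetric convex body is a pairwise intersecting Minkowski arrangement if any two members intersect and no member contains the center of symmetry of any other member in its interior. *)

theory Defs
  imports "HOL-Analysis.Analysis"
begin

definition convex_body :: "'a::euclidean_space set \<Rightarrow> bool" where
  "convex_body K \<longleftrightarrow> compact K \<and> convex K \<and> interior K \<noteq> {}"

definition symmetry_center :: "'a::euclidean_space \<Rightarrow> 'a set \<Rightarrow> bool" where
  "symmetry_center c S \<longleftrightarrow> (\<forall>x\<in>S. 2 *\<^sub>R c - x \<in> S)"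

definition centrally_symmetric :: "'a::euclidean_space set \<Rightarrow> bool" where
  "centrally_symmetric S \<longleftrightarrow> (\<exists>c. symmetry_center c S)"

definition translate_of :: "'a::euclidean_space set \<Rightarrow> 'a set \<Rightarrow> bool" where
  "translate_of K A \<longleftrightarrow> (\<exists>t. A = (+) t ` K)"

definition positive_homothet_of :: "'a::euclidean_space set \<Rightarrow> 'a set \<Rightarrow> bool" where
  "positive_homothet_of K A \<longleftrightarrow> (\<exists>r>0. \<exists>t. A = (\<lambda>x. t + r *\<^sub>R x) ` K)"

(* Bounded non-empty sets have at most one center of symmetry (lemma symmetry_center_unique),
   so quantifying over all centers c of B below refers to the center of B. Since pairwise
   ranges over ordered pairs, the condition is imposed in both directions. *)

definition intersecting_Minkowski_arrangement ::
    "'a::euclidean_space set \<Rightarrow> 'a set set \<Rightarrow> bool" where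
  "intersecting_Minkowski_arrangement K F \<longleftrightarrow>
     (\<forall>A\<in>F. positive_homothet_of K A) \<and>
     pairwise (\<lambda>A B. A \<inter> B \<noteq> {}) F \<and>
     pairwise (\<lambda>A B. \<forall>c. symmetry_center c B \<longrightarrow> c \<notin> interior A) F"

definition translative_arrangement :: "'a::euclidean_space set \<Rightarrow> 'a set set \<Rightarrow> bool" where
  "translative_arrangement K F \<longleftrightarrow>
     (\<forall>A\<in>F. translate_of K A) \<and> intersecting_Minkowski_arrangement K F"

(* The competitors G may be infinite a priori; card is 0 on infinite sets, hence the
   explicit finiteness requirements. *)

definition maximum_translative_arrangement ::
    "'a::euclidean_space set \<Rightarrow> 'a set set \<Rightarrow> bool" where
  "maximum_translative_arrangement K F \<longleftrightarrow>
     translative_arrangement K F \<and> finite F \<and>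
     (\<forall>G. translative_arrangement K G \<longrightarrow> finite G \<and> card G \<le> card F)"

lemma symmetry_center_unique:
  fixes S :: "'a::euclidean_space set"
  assumes "bounded S" "S \<noteq> {}" "symmetry_center c S" "symmetry_center c' S"
  shows "c = c'"
proof (rule ccontr)
  assume ne: "c \<noteq> c'"
  define v where "v = 2 *\<^sub>R (c - c')"
  have "v \<noteq> 0" using ne by (simp add: v_def)
  from \<open>S \<noteq> {}\<close> obtain x where x: "x \<in> S" by blast
  have step: "y + v \<in> S" if "y \<in> S" for y
  proof -
    have "2 *\<^sub>R c - (2 *\<^sub>R c' - y) \<in> S"
      using that assms(3,4) by (simp add: symmetry_center_def)
    also have "2 *\<^sub>R c - (2 *\<^sub>R c' - y) = y + v"
      by (simp add: v_def algebra_simps)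
    finally show ?thesis .
  qed
  have iter: "x + real n *\<^sub>R v \<in> S" for n
  proof (induction n)
    case 0
    then show ?case using x by simp
  next
    case (Suc n)
    have "x + real (Suc n) *\<^sub>R v = (x + real n *\<^sub>R v) + v"
      by (simp add: algebra_simps)
    then show ?case using step[OF Suc] by (simp only:)
  qed
  obtain b where b: "\<And>y. y \<in> S \<Longrightarrow> norm y \<le> b"
    using \<open>bounded S\<close> by (auto simp: bounded_iff)
  obtain n where n: "(b + norm x) / norm v < real n"
    using reals_Archimedean2 by blast
  have "real n * norm v = norm ((x + real n *\<^sub>R v) - x)" by simp
  also have "\<dots> \<le> norm (x + real n *\<^sub>R v) + norm x" by (rule norm_triangle_ineq4)
  also have "\<dots> \<le> b + norm x" using b[OF iter] by simp
  finally show False using n \<open>v \<noteq> 0\<close> by (simp add: field_simps)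
qed

end

theory Submission
  imports Defs
begin

text \<open>
  After moving its center to the origin, \<open>K\<close> is the unit ball of a norm \<open>N\<close> on the space, and a
  translate of \<open>K\<close> is a closed unit ball of \<open>N\<close>. Two such balls intersect exactly if their centers
  are at distance at most \<open>2\<close>, and neither has the center of the other in its interior exactly if
  the distance is at least \<open>1\<close>. So a translative arrangement is the same as a set of points with
  all mutual \<open>N\<close>-distances in the interval from \<open>1\<close> to \<open>2\<close> (\<open>translative_arrangement_iff\<close>), and by
  total boundedness the size of such a set is bounded (\<open>separated_card_bound\<close>), so that a maximum
  exists.

  For the lower bound it suffices to find \<open>2 d + 2\<close> unit vectors at mutual distances at least \<open>1\<close>:
  distances between unit vectors never exceed \<open>2\<close>, and the origin can be added as one more point.
  The vectors come in antipodal pairs. Every plane contains an affinely regular hexagon inscribed in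
  its unit circle (\<open>unit_vector_at_distance_one\<close>), which gives three pairs in dimension \<open>2\<close>. Each
  further dimension gives another pair: by the Riesz lemma, whose bound is attained in
  finite dimension, every proper subspace has a unit vector at distance \<open>1\<close> from it
  (\<open>riesz_unit_vector\<close>).
\<close>

section \<open>Norms on a Euclidean space\<close>

locale norm_function =
  fixes N :: "'a::euclidean_space \<Rightarrow> real"
  assumes scale: "N (a *\<^sub>R x) = \<bar>a\<bar> * N x"
    and triangle: "N (x + y) \<le> N x + N y"
    and definite: "N x = 0 \<Longrightarrow> x = 0"
begin

lemma zero [simp]: "N 0 = 0"
  using scale[of 0 0] by simp

lemma minus [simp]: "N (- x) = N x"
  using scale[of "-1" x] by simp

lemma minus_commute: "N (x - y) = N (y - x)"
  using minus[of "x - y"] by simp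

lemma nonneg: "0 \<le> N x"
  using triangle[of x "- x"] by simp

lemma triangle_diff: "N (x - y) \<le> N x + N y"
  using triangle[of x "- y"] by simp

lemma triangle_via: "N (x - z) \<le> N (x - y) + N (y - z)"
  using triangle[of "x - y" "y - z"] by simp

lemma pos: "x \<noteq> 0 \<Longrightarrow> 0 < N x"
  using definite[of x] nonneg[of x] by linarith

lemma normalize: "x \<noteq> 0 \<Longrightarrow> N (x /\<^sub>R N x) = 1"
  using pos[of x] by (simp add: scale)

lemma le_norm: "N x \<le> (\<Sum>b\<in>Basis. N b) * norm x"
proof -
  have sum_le: "N (\<Sum>b\<in>B. f b) \<le> (\<Sum>b\<in>B. N (f b))" if "finite B" for B :: "'a set" and f
    using that
  proof (induction B rule: finite_induct)
    case (insert b B)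
    then show ?case using triangle[of "f b" "sum f B"] by simp
  qed simp
  have "N x = N (\<Sum>b\<in>Basis. (x \<bullet> b) *\<^sub>R b)" by (simp add: euclidean_representation)
  also have "\<dots> \<le> (\<Sum>b\<in>Basis. N ((x \<bullet> b) *\<^sub>R b))" by (rule sum_le) simp
  also have "\<dots> \<le> (\<Sum>b\<in>Basis. N b * norm x)"
    by (intro sum_mono) (simp add: scale mult.commute Basis_le_norm mult_left_mono nonneg)
  finally show ?thesis by (simp add: sum_distrib_right)
qed

lemma continuous_on_norm: "continuous_on S N"
proof -
  define L where "L = (\<Sum>b\<in>Basis. N b)"
  have diff: "N x - N y \<le> L * norm (x - y)" for x y
    using triangle[of "x - y" y] le_norm[of "x - y"] by (simp add: L_def)
  have "L-lipschitz_on S N"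
  proof (rule lipschitz_onI)
    fix x y
    show "dist (N x) (N y) \<le> L * dist x y"
      using diff[of x y] diff[of y x] by (simp add: dist_norm norm_minus_commute abs_le_iff)
    show "0 \<le> L" by (simp add: L_def nonneg sum_nonneg)
  qed
  then show ?thesis by (rule lipschitz_on_continuous_on)
qed

lemmas continuous_on_norm_comp [continuous_intros] =
  continuous_on_compose2[OF continuous_on_norm[of UNIV] _ subset_UNIV]

lemma norm_le:
  obtains m where "0 < m" "\<And>x. norm x \<le> m * N x"
proof -
  obtain b :: 'a where "b \<in> Basis" by (rule SOME_Basis[THEN that])
  then have ne: "sphere (0::'a) 1 \<noteq> {}" by force
  obtain s where s: "s \<in> sphere 0 1" "\<And>x. x \<in> sphere 0 1 \<Longrightarrow> N s \<le> N x"
    using continuous_attains_inf[OF compact_sphere ne continuous_on_norm] by blast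
  have Ns: "0 < N s" using s(1) by (intro pos) auto
  have "norm x \<le> (1 / N s) * N x" for x
  proof (cases "x = 0")
    case False
    have "N s \<le> N (x /\<^sub>R norm x)" using False by (intro s(2)) simp
    also have "\<dots> = N x / norm x" by (simp add: scale divide_inverse mult.commute)
    finally show ?thesis using False Ns by (simp add: field_simps)
  qed simp
  then show ?thesis using Ns by (intro that[of "1 / N s"]) auto
qed

lemma bounded_of_le:
  assumes "\<And>x. x \<in> S \<Longrightarrow> N x \<le> r"
  shows "bounded S"
proof -
  obtain m where m: "0 < m" "\<And>x. norm x \<le> m * N x" using norm_le by blast
  have "norm x \<le> m * r" if "x \<in> S" for x
    using m(2)[of x] mult_left_mono[OF assms[OF that], of m] m(1) by linarith
  then show ?thesis by (auto simp: bounded_iff)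
qed

section \<open>Separated systems of unit vectors\<close>

text \<open>The normalized difference between a point outside the subspace and a nearest point of the
  subspace is orthogonal to it in the sense of Birkhoff. A nearest point exists because the
  candidates form a compact set.\<close>

lemma riesz_unit_vector:
  assumes H: "subspace H" and x: "x \<notin> H"
  obtains e where "e \<in> span (insert x H)" "N e = 1" "\<And>h. h \<in> H \<Longrightarrow> 1 \<le> N (e - h)"
proof -
  define S where "S = {y \<in> H. N (x - y) \<le> N x}"
  have "N y \<le> 2 * N x" if "y \<in> S" for y
    using that triangle_diff[of x "x - y"] by (simp add: S_def)
  then have "bounded S" by (rule bounded_of_le)
  moreover have "closed S"
  proof -
    have "closed {y. N (x - y) \<le> N x}"
      by (intro closed_Collect_le continuous_intros)
    then show ?thesis
      using closed_Int[OF closed_subspace[OF H]] by (simp add: S_def Collect_conj_eq)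
  qed
  ultimately have cpt: "compact S" by (simp add: compact_eq_bounded_closed)
  have "0 \<in> S" using subspace_0[OF H] by (simp add: S_def)
  then have "S \<noteq> {}" by blast
  moreover have "continuous_on S (\<lambda>y. N (x - y))" by (intro continuous_intros)
  ultimately obtain p where p: "p \<in> S" "\<And>y. y \<in> S \<Longrightarrow> N (x - p) \<le> N (x - y)"
    using continuous_attains_inf[OF cpt] by blast
  have pH: "p \<in> H" using p(1) by (simp add: S_def)
  have near: "N (x - p) \<le> N (x - y)" if "y \<in> H" for y
    using p that by (cases "y \<in> S") (auto simp: S_def)
  have ne: "x - p \<noteq> 0" using x pH by auto
  define e where "e = (x - p) /\<^sub>R N (x - p)"
  show ?thesis
  proof
    show "e \<in> span (insert x H)"
      unfolding e_def using pH by (intro span_scale span_diff span_base) auto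
    show "N e = 1" unfolding e_def by (rule normalize[OF ne])
    fix h assume h: "h \<in> H"
    have "p + N (x - p) *\<^sub>R h \<in> H" using H pH h by (simp add: subspace_add subspace_scale)
    from near[OF this] have "N (x - p) \<le> N ((x - p) - N (x - p) *\<^sub>R h)"
      by (simp only: diff_diff_eq)
    also have "(x - p) - N (x - p) *\<^sub>R h = N (x - p) *\<^sub>R (e - h)"
      using pos[OF ne] by (simp add: e_def scaleR_right_diff_distrib)
    finally have "N (x - p) \<le> N (N (x - p) *\<^sub>R (e - h))" .
    then show "1 \<le> N (e - h)" using pos[OF ne] by (simp add: scale)
  qed
qed

text \<open>Turning a unit vector by half a circle moves it continuously from itself to its antipode, so
  its distance from the start takes every value between \<open>0\<close> and \<open>2\<close>.\<close>

lemma unit_vector_at_distance_one: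
  assumes x: "x \<noteq> 0" and y: "y \<notin> span {x}"
  obtains a b where "a \<in> span {y, x}" "b \<in> span {y, x}" "N a = 1" "N b = 1" "N (a - b) = 1"
proof -
  define u where "u t = cos t *\<^sub>R x + sin t *\<^sub>R y" for t :: real
  define v where "v t = u t /\<^sub>R N (u t)" for t
  have u: "u t \<noteq> 0" for t
  proof
    assume eq: "u t = 0"
    have "sin t = 0"
    proof (rule ccontr)
      assume s: "sin t \<noteq> 0"
      have "sin t *\<^sub>R y = (- cos t) *\<^sub>R x"
        using eq by (simp add: u_def eq_neg_iff_add_eq_0 add.commute)
      then have "y = inverse (sin t) *\<^sub>R (- cos t) *\<^sub>R x"
        using s by (metis scaleR_scaleR left_inverse scaleR_one)
      then have "y \<in> span {x}" by (simp add: span_base span_scale span_neg)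
      with y show False by blast
    qed
    moreover from this have "cos t \<noteq> 0" using sin_cos_squared_add[of t] by auto
    ultimately show False using eq x by (simp add: u_def)
  qed
  have Nu: "N (u t) \<noteq> 0" for t using pos[OF u[of t]] by simp
  have "continuous_on {0..pi} (\<lambda>t. N (v 0 - v t))"
    unfolding v_def using Nu unfolding u_def by (intro continuous_intros) auto
  moreover have "v pi = - v 0" by (simp add: v_def u_def)
  then have "N (v 0 - v pi) = N (2 *\<^sub>R v 0)" by (simp add: scaleR_2)
  then have "N (v 0 - v pi) = 2 * N (v 0)" by (simp only: scale abs_numeral)
  then have "N (v 0 - v pi) = 2" using normalize[OF u[of 0]] by (simp only: v_def)
  ultimately obtain t where t: "N (v 0 - v t) = 1"
    using IVT'[of "\<lambda>t. N (v 0 - v t)" 0 1 pi] by auto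
  have "v t \<in> span {y, x}" for t
    unfolding v_def u_def by (intro span_scale span_add span_base) auto
  moreover have "N (v t) = 1" for t unfolding v_def by (rule normalize[OF u])
  ultimately show ?thesis using t by (intro that)
qed

definition antipodal_system :: "'a set \<Rightarrow> bool" where
  "antipodal_system S \<longleftrightarrow> finite S \<and> (\<forall>x\<in>S. - x \<in> S) \<and> (\<forall>x\<in>S. N x = 1) \<and>
     pairwise (\<lambda>x y. 1 \<le> N (x - y)) S"

text \<open>Both the hexagon and the systems in higher dimensions are built by repeating this step. By
  symmetry of the system, only the distances from one of the two new vectors have to be checked.\<close>

lemma antipodal_system_insert:
  assumes S: "antipodal_system S" and b: "N b = 1" and far: "\<And>s. s \<in> S \<Longrightarrow> 1 \<le> N (b - s)"
  shows "antipodal_system (insert b (insert (- b) S))"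
    and "card (insert b (insert (- b) S)) = card S + 2"
proof -
  have far': "1 \<le> N (- b - s)" if "s \<in> S" for s
    using far[of "- s"] S that minus[of "b + s"] by (simp add: antipodal_system_def)
  have "N (b - - b) = N (2 *\<^sub>R b)" by (simp add: scaleR_2)
  then have bb: "N (b - - b) = 2" using b by (simp add: scale)
  have "b \<noteq> - b" using bb by (metis right_minus_eq zero zero_neq_numeral)
  moreover have "b \<notin> S" using far[of b] by auto
  moreover have "- b \<notin> S" using far'[of "- b"] by auto
  moreover have "finite S" using S by (simp add: antipodal_system_def)
  ultimately show "card (insert b (insert (- b) S)) = card S + 2" by simp
  have bb': "1 \<le> N (b - - b)" "1 \<le> N (- b - b)"
    using bb minus_commute[of b "- b"] by simp_all
  have "1 \<le> N (s - b)" "1 \<le> N (s - - b)" if "s \<in> S" for s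
    using far[OF that] far'[OF that] by (simp_all only: minus_commute[of s])
  then have "pairwise (\<lambda>x y. 1 \<le> N (x - y)) (insert b (insert (- b) S))"
    using S bb' far far' unfolding antipodal_system_def pairwise_insert by blast
  then show "antipodal_system (insert b (insert (- b) S))"
    using S b unfolding antipodal_system_def by simp
qed

text \<open>The vertices of the hexagon are \<open>\<plusminus>a\<close>, \<open>\<plusminus>b\<close> and \<open>\<plusminus>(a - b)\<close>. Consecutive vertices are at
  distance \<open>1\<close>, and the remaining distances are at least \<open>1\<close> by the triangle inequality.\<close>

lemma antipodal_system_plane:
  assumes x: "x \<noteq> 0" and y: "y \<notin> span {x}"
  obtains S where "S \<subseteq> span {y, x}" "antipodal_system S" "card S = 6"
proof -
  obtain a b where ab: "a \<in> span {y, x}" "b \<in> span {y, x}"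
    and N: "N a = 1" "N b = 1" "N (a - b) = 1"
    using unit_vector_at_distance_one[OF x y] by blast
  have two: "N (2 *\<^sub>R z) = 2 * N z" for z by (simp add: scale)
  have far_b: "1 \<le> N (b - s)" if "s \<in> {a, - a}" for s
    using that triangle[of "a + b" "a - b"] two[of a] N
    by (auto simp: scaleR_2 minus_commute[of b a] add.commute)
  have far_c: "1 \<le> N ((a - b) - s)" if "s \<in> {b, - b, a, - a}" for s
  proof -
    have "1 \<le> N (a - b - b)"
      using triangle_diff[of "a - b - b" a] two[of b] N minus[of "b + b"]
      by (simp add: scaleR_2)
    moreover have "1 \<le> N (a - b + a)"
      using triangle[of "a - b + a" b] two[of a] N by (simp add: scaleR_2)
    ultimately show ?thesis using that N by auto
  qed
  have 0: "antipodal_system {}" by (simp add: antipodal_system_def)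
  note 1 = antipodal_system_insert[OF 0 N(1), simplified]
  note 2 = antipodal_system_insert[OF 1(1) N(2) far_b]
  note 3 = antipodal_system_insert[OF 2(1) N(3) far_c]
  show ?thesis
  proof (rule that)
    show "antipodal_system {a - b, - (a - b), b, - b, a, - a}" by (rule 3(1))
    show "card {a - b, - (a - b), b, - b, a, - a} = 6" using 1(2) 2(2) 3(2) by simp
    show "{a - b, - (a - b), b, - b, a, - a} \<subseteq> span {y, x}"
      using ab by (auto intro: span_diff span_neg)
  qed
qed

lemma antipodal_system_subspace:
  assumes "2 \<le> n" "n \<le> DIM('a)"
  shows "\<exists>H S. subspace H \<and> dim H = n \<and> S \<subseteq> H \<and> antipodal_system S \<and> card S = 2 * n + 2"
  using assms
proof (induction n rule: dec_induct)
  case base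
  obtain x :: 'a where "x \<in> Basis" by (rule SOME_Basis[THEN that])
  then have x: "x \<noteq> 0" by (rule nonzero_Basis)
  then have d1: "dim (span {x}) = 1" by (simp add: dim_insert)
  have "span {x} \<noteq> UNIV"
    using d1 base dim_UNIV[where ?'a = 'a]
    by (metis not_less_eq_eq numeral_2_eq_2 One_nat_def order_refl)
  then obtain y where y: "y \<notin> span {x}" by blast
  obtain S where "S \<subseteq> span {y, x}" "antipodal_system S" "card S = 6"
    by (rule antipodal_system_plane[OF x y])
  moreover have "dim (span {y, x}) = 2" using x y by (simp add: dim_insert)
  ultimately show ?case by (intro exI[of _ "span {y, x}"] exI[of _ S]) simp
next
  case (step n)
  then obtain H S where H: "subspace H" "dim H = n" and S: "S \<subseteq> H" "antipodal_system S"
    and card: "card S = 2 * n + 2" by auto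
  have "H \<noteq> UNIV" using H(2) step by auto
  then obtain x where x: "x \<notin> H" by blast
  obtain e where e: "e \<in> span (insert x H)" "N e = 1" "\<And>h. h \<in> H \<Longrightarrow> 1 \<le> N (e - h)"
    using riesz_unit_vector[OF H(1) x] by blast
  note ins = antipodal_system_insert[OF S(2) e(2) e(3)]
  have "dim (span (insert x H)) = Suc n"
    using x H by (simp add: dim_insert span_eq_iff[THEN iffD2])
  moreover have "insert e (insert (- e) S) \<subseteq> span (insert x H)"
    using e(1) S(1) by (auto intro: span_neg span_base)
  ultimately show ?case
    using ins S(1) card
    by (intro exI[of _ "span (insert x H)"] exI[of _ "insert e (insert (- e) S)"]) auto
qed

section \<open>Points at mutual distances between one and two\<close>

abbreviation centers :: "'a set \<Rightarrow> bool" where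
  "centers \<equiv> pairwise (\<lambda>x y. 1 \<le> N (x - y) \<and> N (x - y) \<le> 2)"

lemma exists_many_centers:
  assumes "2 \<le> DIM('a)"
  obtains S where "centers S" "finite S" "card S = 2 * DIM('a) + 3"
proof -
  obtain S where S: "antipodal_system S" "card S = 2 * DIM('a) + 2"
    using antipodal_system_subspace[OF assms order_refl] by blast
  have fin: "finite S" and unit: "\<And>x. x \<in> S \<Longrightarrow> N x = 1"
    and sep: "pairwise (\<lambda>x y. 1 \<le> N (x - y)) S"
    using S(1) by (auto simp: antipodal_system_def)
  have "0 \<notin> S" using unit[of 0] by auto
  moreover have "N (x - y) \<le> 2" if "x \<in> S" "y \<in> S" for x y
    using triangle_diff[of x y] unit[OF that(1)] unit[OF that(2)] by simp
  then have "centers (insert 0 S)"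
    using sep unit by (auto simp: pairwise_insert pairwise_def)
  ultimately show ?thesis using S(2) fin by (intro that[of "insert 0 S"]) auto
qed

text \<open>The bound has to be uniform in the set of points. A translation brings all points into one fixed
  ball of radius \<open>2\<close>, which is covered by finitely many open balls of radius \<open>1 / 2\<close>, and each of
  these contains at most one of the points.\<close>

lemma separated_card_bound:
  obtains n where "\<And>S. centers S \<Longrightarrow> finite S \<and> card S \<le> n"
proof -
  define V where "V q = {z. N (z - q) < 1 / 2}" for q
  define D where "D = {z. N z \<le> 2}"
  have "closed D" unfolding D_def by (intro closed_Collect_le continuous_intros)
  moreover have "bounded D" by (rule bounded_of_le[of D 2]) (simp add: D_def)
  ultimately have "compact D" by (simp add: compact_eq_bounded_closed)
  moreover have "open (V q)" for q
    unfolding V_def by (intro open_Collect_less continuous_intros)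
  moreover have "q \<in> V q" for q by (simp add: V_def)
  then have "D \<subseteq> (\<Union>q\<in>D. V q)" by blast
  ultimately obtain Q where Q: "finite Q" "D \<subseteq> (\<Union>q\<in>Q. V q)"
    by (rule compactE_image)
  have "finite S \<and> card S \<le> card Q" if S: "centers S" for S
  proof (cases "S = {}")
    case False
    then obtain s where s: "s \<in> S" by blast
    have "x - s \<in> D" if "x \<in> S" for x
      using S s that by (cases "x = s") (auto simp: D_def pairwise_def)
    with Q(2) have "\<forall>x\<in>S. \<exists>q\<in>Q. x - s \<in> V q" by blast
    then obtain f where f: "\<And>x. x \<in> S \<Longrightarrow> f x \<in> Q \<and> x - s \<in> V (f x)" by metis
    have "inj_on f S"
    proof (rule inj_onI, rule ccontr)
      fix x y assume xy: "x \<in> S" "y \<in> S" "f x = f y" "x \<noteq> y"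
      have "N (x - y) \<le> N ((x - s) - f x) + N (f x - (y - s))"
        using triangle_via[of "x - s" "y - s" "f x"] by simp
      also have "\<dots> < 1"
        using f[OF xy(1)] f[OF xy(2)] xy(3) minus_commute[of "f x" "y - s"] by (simp add: V_def)
      finally show False using pairwiseD[OF S xy(1,2,4)] by simp
    qed
    moreover have "f ` S \<subseteq> Q" using f by blast
    ultimately show ?thesis using Q(1) card_inj_on_le inj_on_finite by blast
  qed simp
  then show ?thesis by (rule that)
qed

section \<open>Arrangements of unit balls\<close>

definition unit_ball :: "'a \<Rightarrow> 'a set" where
  "unit_ball x = {z. N (z - x) \<le> 1}"

lemma symmetry_center_unit_ball: "symmetry_center p (unit_ball x) \<longleftrightarrow> p = x"
proof -
  have center: "symmetry_center x (unit_ball x)"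
    using minus_commute by (auto simp: symmetry_center_def unit_ball_def scaleR_2)
  have ne: "unit_ball x \<noteq> {}" by (auto simp: unit_ball_def intro: exI[of _ x])
  have "N z \<le> 1 + N x" if "z \<in> unit_ball x" for z
    using that triangle[of "z - x" x] by (simp add: unit_ball_def)
  then have "bounded (unit_ball x)" by (rule bounded_of_le)
  with center ne show ?thesis using symmetry_center_unique by blast
qed

lemma unit_balls_intersect: "unit_ball x \<inter> unit_ball y \<noteq> {} \<longleftrightarrow> N (x - y) \<le> 2"
proof
  assume "unit_ball x \<inter> unit_ball y \<noteq> {}"
  then obtain z where "N (z - x) \<le> 1" "N (z - y) \<le> 1" by (auto simp: unit_ball_def)
  then show "N (x - y) \<le> 2" using triangle_via[of x y z] minus_commute[of x z] by linarith
next
  assume le: "N (x - y) \<le> 2"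
  define z where "z = (1 / 2) *\<^sub>R (x + y)"
  have "z - y = (1 / 2) *\<^sub>R (x - y)" "z - x = (1 / 2) *\<^sub>R (y - x)"
    by (simp_all add: z_def algebra_simps flip: scaleR_left_distrib)
  then have "z \<in> unit_ball x \<inter> unit_ball y"
    using le minus_commute[of x y] by (simp add: unit_ball_def scale)
  then show "unit_ball x \<inter> unit_ball y \<noteq> {}" by blast
qed

lemma interior_unit_ball: "y \<in> interior (unit_ball x) \<longleftrightarrow> N (y - x) < 1"
proof
  assume "N (y - x) < 1"
  moreover have "open {z. N (z - x) < 1}" by (intro open_Collect_less continuous_intros)
  moreover have "{z. N (z - x) < 1} \<subseteq> unit_ball x" by (auto simp: unit_ball_def)
  ultimately show "y \<in> interior (unit_ball x)" by (blast intro: interiorI)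
next
  assume y: "y \<in> interior (unit_ball x)"
  show "N (y - x) < 1"
  proof (cases "y = x")
    case False
    obtain r where r: "0 < r" "ball y r \<subseteq> unit_ball x"
      using y by (auto simp: mem_interior)
    \<comment> \<open>Moving \<open>y\<close> outwards a little along the ray from \<open>x\<close> still stays inside the ball.\<close>
    define t where "t = r / (2 * norm (y - x))"
    have t: "0 < t" using r(1) False by (simp add: t_def)
    have "dist y (y + t *\<^sub>R (y - x)) = r / 2" using r(1) False by (simp add: dist_norm t_def)
    with r have "y + t *\<^sub>R (y - x) \<in> unit_ball x" by auto
    moreover have "y + t *\<^sub>R (y - x) - x = (1 + t) *\<^sub>R (y - x)" by (simp add: algebra_simps)
    ultimately have "(1 + t) * N (y - x) \<le> 1" using t by (simp add: unit_ball_def scale)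
    moreover have "N (y - x) < (1 + t) * N (y - x)" using t False pos[of "y - x"] by simp
    ultimately show ?thesis by linarith
  qed simp
qed

lemma inj_unit_ball: "inj unit_ball"
  by (rule injI) (metis symmetry_center_unit_ball)

lemma translate_of_unit_ball: "translate_of (unit_ball c) A \<longleftrightarrow> (\<exists>x. A = unit_ball x)"
proof -
  have tr: "(+) t ` unit_ball c = unit_ball (t + c)" for t
  proof (intro equalityI subsetI)
    fix z assume "z \<in> unit_ball (t + c)"
    then have "z - t \<in> unit_ball c" by (simp add: unit_ball_def diff_diff_eq)
    then show "z \<in> (+) t ` unit_ball c" by (rule rev_image_eqI) simp
  qed (auto simp: unit_ball_def)
  have "unit_ball x = (+) (x - c) ` unit_ball c" for x by (simp add: tr)
  then show ?thesis unfolding translate_of_def using tr by blast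
qed

lemma translative_arrangement_iff:
  "translative_arrangement (unit_ball c) F \<longleftrightarrow> (\<exists>S. F = unit_ball ` S \<and> centers S)"
proof -
  have hom: "positive_homothet_of K A" if "translate_of K A" for K A :: "'a set"
    using that unfolding translate_of_def positive_homothet_of_def
    by (metis (no_types, lifting) image_cong scaleR_one zero_less_one)
  have ball: "(\<forall>A\<in>F. translate_of (unit_ball c) A) \<longleftrightarrow> (\<exists>S. F = unit_ball ` S)"
    unfolding translate_of_unit_ball
    by (auto simp: subset_image_iff[of F unit_ball UNIV, simplified, symmetric])
  have pair: "pairwise (\<lambda>A B. A \<inter> B \<noteq> {}) (unit_ball ` S) \<and>
      pairwise (\<lambda>A B. \<forall>p. symmetry_center p B \<longrightarrow> p \<notin> interior A) (unit_ball ` S) \<longleftrightarrow>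
      centers S" for S
    using inj_unit_ball[THEN inj_eq]
    by (auto simp: pairwise_def unit_balls_intersect symmetry_center_unit_ball
        interior_unit_ball not_less minus_commute)
  have "translative_arrangement (unit_ball c) F \<longleftrightarrow>
      (\<forall>A\<in>F. translate_of (unit_ball c) A) \<and>
      pairwise (\<lambda>A B. A \<inter> B \<noteq> {}) F \<and>
      pairwise (\<lambda>A B. \<forall>p. symmetry_center p B \<longrightarrow> p \<notin> interior A) F"
    unfolding translative_arrangement_def intersecting_Minkowski_arrangement_def
    using hom by auto
  also have "\<dots> \<longleftrightarrow> (\<exists>S. F = unit_ball ` S \<and> centers S)"
    unfolding ball pair[symmetric] by auto
  finally show ?thesis .
qed

end

section \<open>The norm of a symmetric convex body\<close>

text \<open>The norm is the Minkowski functional of the body. As the body is closed and star-shaped around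
  the origin, for \<open>r > 0\<close> the point \<open>x\<close> lies in the \<open>r\<close>-fold copy of \<open>C\<close> exactly if \<open>N x \<le> r\<close>. The
  norm axioms are properties of \<open>C\<close> read through this equivalence: convexity gives the triangle
  inequality, symmetry gives \<open>N (- x) = N x\<close>, and boundedness gives definiteness.\<close>

lemma symmetric_body_is_unit_ball:
  fixes C :: "'a::euclidean_space set"
  assumes cpt: "compact C" and conv: "convex C" and int: "interior C \<noteq> {}"
    and sym: "\<And>x. x \<in> C \<Longrightarrow> - x \<in> C"
  obtains N where "norm_function N" "C = {x. N x \<le> 1}"
proof -
  obtain z e where e: "0 < e" "ball z e \<subseteq> C" using int by (auto simp: mem_interior)
  \<comment> \<open>Each \<open>w\<close> near the origin is the midpoint of \<open>z + w\<close> and the reflected point \<open>w - z\<close>.\<close>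
  have near0: "w \<in> C" if "norm w < e" for w
  proof -
    have "z + w \<in> C" "z - w \<in> C" using e(2) that by (auto simp: subset_iff dist_norm)
    then have "z + w \<in> C" "w - z \<in> C" using sym[of "z - w"] by auto
    then have "(1 / 2) *\<^sub>R (z + w) + (1 / 2) *\<^sub>R (w - z) \<in> C"
      using convexD[OF conv] by simp
    then show ?thesis by (simp add: algebra_simps flip: scaleR_left_distrib)
  qed
  have C0: "0 \<in> C" using near0[of 0] e by simp
  obtain M where M: "\<And>x. x \<in> C \<Longrightarrow> norm x \<le> M"
    using compact_imp_bounded[OF cpt] by (auto simp: bounded_iff)
  define R where "R x = {r. 0 < r \<and> x /\<^sub>R r \<in> C}" for x
  define N where "N x = Inf (R x)" for x
  have ne: "R x \<noteq> {}" for x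
  proof -
    define r where "r = (norm x + 1) / e"
    have r: "0 < r" using e by (simp add: r_def add_nonneg_pos)
    have "norm (x /\<^sub>R r) < e"
    proof -
      have "norm x / r < e" using e r by (simp add: r_def field_simps)
      then show ?thesis using r by (simp add: field_simps)
    qed
    then show ?thesis using r near0 by (auto simp: R_def)
  qed
  have bdd: "bdd_below (R x)" for x by (auto simp: R_def intro!: bdd_belowI[of _ 0])
  have N0: "0 \<le> N x" for x
    unfolding N_def by (rule cInf_greatest[OF ne]) (simp add: R_def)
  have above: "x /\<^sub>R s \<in> C" if lt: "N x < s" for x s
  proof -
    obtain r where r: "r \<in> R x" "r < s"
      using lt unfolding N_def cInf_less_iff[OF ne bdd] by blast
    have "(r / s) *\<^sub>R (x /\<^sub>R r) + (1 - r / s) *\<^sub>R 0 \<in> C"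
      using r C0 by (intro convexD[OF conv]) (auto simp: R_def)
    then show ?thesis using r by (simp add: R_def field_simps)
  qed
  have key: "x /\<^sub>R r \<in> C \<longleftrightarrow> N x \<le> r" if r: "0 < r" for x r
  proof
    assume "x /\<^sub>R r \<in> C"
    then have "r \<in> R x" using r by (simp add: R_def)
    then show "N x \<le> r" unfolding N_def using bdd by (rule cInf_lower)
  next
    assume le: "N x \<le> r"
    have "x /\<^sub>R (r + 1 / real (Suc n)) \<in> C" for n
      by (rule above) (use le in \<open>simp add: add_increasing2 le_less_trans\<close>)
    moreover have "(\<lambda>n. r + 1 / real (Suc n)) \<longlonglongrightarrow> r + 0"
      by (intro tendsto_add tendsto_const LIMSEQ_Suc[OF lim_1_over_n])
    then have "(\<lambda>n. x /\<^sub>R (r + 1 / real (Suc n))) \<longlonglongrightarrow> x /\<^sub>R (r + 0)"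
      using r by (intro tendsto_scaleR tendsto_inverse tendsto_const) auto
    ultimately have "x /\<^sub>R (r + 0) \<in> C"
      by (rule closed_sequentially[OF compact_imp_closed[OF cpt]])
    then show "x /\<^sub>R r \<in> C" by simp
  qed
  \<comment> \<open>By the equivalence, \<open>N x\<close> is determined by its positive upper bounds.\<close>
  have N_eq: "N x = N' " if "0 \<le> N'" "\<And>r. 0 < r \<Longrightarrow> x /\<^sub>R r \<in> C \<longleftrightarrow> N' \<le> r" for x N'
  proof (rule antisym)
    show "N x \<le> N'"
      by (rule dense_ge) (use that key in \<open>meson le_less_trans less_imp_le\<close>)
    show "N' \<le> N x"
      by (rule dense_ge) (use N0[of x] that key in \<open>meson le_less_trans less_imp_le\<close>)
  qed
  have "norm_function N"
  proof
    fix x y :: 'a and a :: real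
    have "(a *\<^sub>R x) /\<^sub>R r \<in> C \<longleftrightarrow> \<bar>a\<bar> * N x \<le> r" if r: "0 < r" for r
    proof (cases "a = 0")
      case False
      have "(a *\<^sub>R x) /\<^sub>R r \<in> C \<longleftrightarrow> (\<bar>a\<bar> *\<^sub>R x) /\<^sub>R r \<in> C"
        using sym[of "(a *\<^sub>R x) /\<^sub>R r"] sym[of "- ((a *\<^sub>R x) /\<^sub>R r)"] by (auto simp: abs_if)
      also have "(\<bar>a\<bar> *\<^sub>R x) /\<^sub>R r = x /\<^sub>R (r / \<bar>a\<bar>)" by (simp add: divide_inverse mult.commute)
      also have "\<dots> \<in> C \<longleftrightarrow> N x \<le> r / \<bar>a\<bar>" using False r by (intro key) simp
      finally show ?thesis using False by (simp add: field_simps)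
    qed (use C0 r in simp)
    then show "N (a *\<^sub>R x) = \<bar>a\<bar> * N x" using N0 by (intro N_eq) auto
    show "N (x + y) \<le> N x + N y"
    proof (rule field_le_epsilon)
      fix \<epsilon> :: real assume \<epsilon>: "0 < \<epsilon>"
      define r where "r = N x + \<epsilon> / 2"
      define s where "s = N y + \<epsilon> / 2"
      have rs: "0 < r" "0 < s" using N0[of x] N0[of y] \<epsilon> by (auto simp: r_def s_def)
      have "x /\<^sub>R r \<in> C" "y /\<^sub>R s \<in> C" using \<epsilon> by (auto intro!: above simp: r_def s_def)
      then have "(r / (r + s)) *\<^sub>R (x /\<^sub>R r) + (s / (r + s)) *\<^sub>R (y /\<^sub>R s) \<in> C"
        using rs by (intro convexD[OF conv]) (auto simp flip: add_divide_distrib)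
      also have "(r / (r + s)) *\<^sub>R (x /\<^sub>R r) + (s / (r + s)) *\<^sub>R (y /\<^sub>R s) = (x + y) /\<^sub>R (r + s)"
        using rs by (simp add: scaleR_right_distrib inverse_eq_divide)
      finally have "N (x + y) \<le> r + s" using rs key[of "r + s"] by simp
      then show "N (x + y) \<le> N x + N y + \<epsilon>" by (simp add: r_def s_def)
    qed
    assume zero: "N x = 0"
    \<comment> \<open>Otherwise all positive multiples of \<open>x\<close> lie in the bounded set \<open>C\<close>.\<close>
    show "x = 0"
    proof (rule ccontr)
      assume "x \<noteq> 0"
      define r where "r = norm x / (\<bar>M\<bar> + 1)"
      have r: "0 < r" using \<open>x \<noteq> 0\<close> by (simp add: r_def add_nonneg_pos)
      then have "norm (x /\<^sub>R r) \<le> M" using zero by (intro M above) simp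
      moreover have "norm (x /\<^sub>R r) = \<bar>M\<bar> + 1"
        using \<open>x \<noteq> 0\<close> by (simp add: r_def)
      ultimately show False by linarith
    qed
  qed
  moreover have "C = {x. N x \<le> 1}" using key[of 1] by auto
  ultimately show ?thesis by (rule that)
qed

lemma convex_body_is_unit_ball:
  fixes K :: "'a::euclidean_space set"
  assumes "convex_body K" "centrally_symmetric K"
  obtains N c where "norm_function N" "K = norm_function.unit_ball N c"
proof -
  obtain c where c: "\<And>x. x \<in> K \<Longrightarrow> 2 *\<^sub>R c - x \<in> K"
    using assms(2) by (auto simp: centrally_symmetric_def symmetry_center_def)
  define C where "C = (+) (- c) ` K"
  have memC: "x \<in> C \<longleftrightarrow> c + x \<in> K" for x
    by (auto simp: C_def intro: rev_image_eqI)
  have "compact C" "convex C" "interior C \<noteq> {}"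
    using assms(1) unfolding C_def convex_body_def
    by (simp_all only: compact_translation convex_translation interior_translation image_is_empty
        simp_thms)
  moreover have "- x \<in> C" if "x \<in> C" for x
    using c[of "c + x"] that by (simp add: memC scaleR_2)
  ultimately obtain N where N: "norm_function N" "C = {x. N x \<le> 1}"
    by (rule symmetric_body_is_unit_ball)
  then have "x \<in> K \<longleftrightarrow> N (x - c) \<le> 1" for x using memC[of "x - c"] by simp
  then show ?thesis
    using N(1) by (intro that[of N c]) (auto simp: norm_function.unit_ball_def)
qed

section \<open>The cardinality of a maximum arrangement\<close>

theorem proposition1:
  fixes K :: "(real ^ 'n) set"
  assumes "CARD('n) \<ge> 2"
    and "convex_body K"
    and "centrally_symmetric K"
  shows "(\<exists>F. maximum_translative_arrangement K F) \<and>
    (\<forall>F. maximum_translative_arrangement K F \<longrightarrow> card F \<ge> 2 * CARD('n) + 3)"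
proof -
  obtain N c where N: "norm_function N" and K: "K = norm_function.unit_ball N c"
    by (rule convex_body_is_unit_ball[OF assms(2,3)])
  interpret norm_function N by (rule N)
  have card_eq: "card (unit_ball ` S) = card S" for S
    by (rule card_image) (rule inj_on_subset[OF inj_unit_ball subset_UNIV])
  obtain n where n: "\<And>S. centers S \<Longrightarrow> finite S \<and> card S \<le> n"
    using separated_card_bound by blast
  have bound: "finite F \<and> card F \<le> n" if "translative_arrangement K F" for F
    using that n unfolding K translative_arrangement_iff by (auto simp: card_eq)
  have "2 \<le> DIM(real ^ 'n)" using assms(1) by simp
  then obtain S where S: "centers S" "card S = 2 * DIM(real ^ 'n) + 3"
    using exists_many_centers by blast
  then have large: "translative_arrangement K (unit_ball ` S)"
    and large_card: "card (unit_ball ` S) = 2 * CARD('n) + 3"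
    unfolding K translative_arrangement_iff by (auto simp: card_eq)
  obtain F where "translative_arrangement K F"
      "\<forall>G. translative_arrangement K G \<longrightarrow> card G \<le> card F"
    using ex_has_greatest_nat[of "translative_arrangement K" _ card "Suc n"] large bound
    by (metis le_imp_less_Suc)
  then have "maximum_translative_arrangement K F"
    using bound by (auto simp: maximum_translative_arrangement_def)
  moreover have "2 * CARD('n) + 3 \<le> card F" if "maximum_translative_arrangement K F" for F
    using that large large_card unfolding maximum_translative_arrangement_def by metis
  ultimately show ?thesis by blast
qed

end
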